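(* Let $G>0$, $T>0$, and let $F\colon\mathbb R\to\mathbb R^2$ be $T$-periodic and of class $C^1$. Then the equation \[ \ddot x=\left(G\sqrt{1-|x|^2}-\frac{(x^T\dot x)^2}{1-|x|^2}-|\dot x|^2\right)x+(x^TF(t))x-F(t) \] has a $T$-periodic solution $x\colon\mathbb R\to\{z\in\mathbb R^2:|z|<1\}$.
   Context: $|\cdot|$ denotes the Euclidean norm on $\mathbb R^2$ and $x^Ty$ the scalar product. *)

theory Defs
  imports "HOL-Analysis.Analysis"
begin

end

theory Submission
  imports Defs
begin

text \<open>
  Lift \<open>x\<close> to the point \<open>q = (x, sqrt (1 - |x|^2))\<close> of the upper unit hemisphere and put
  \<open>N = (F, G)\<close>. The equation becomes \<open>q'' = (N \<bullet> q - |q'|^2) q - N\<close>, the Euler-Lagrange equation of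
  the action \<open>\<integral> |q'|^2 / 2 - N \<bullet> q\<close> on loops in the sphere. Since \<open>G > 0\<close>, reflecting a loop into the
  upper hemisphere does not increase the action, so a minimizer should exist there; the equator is
  not touched because there \<open>q''\<close> points downwards.

  The minimization is carried out after discretizing time with step \<open>h = T / n\<close>, where it amounts to
  maximizing \<open>\<Sum> q\<^sub>k \<bullet> q\<^sub>k\<^sub>+\<^sub>1 + h^2 N\<^sub>k \<bullet> q\<^sub>k\<close> over \<open>n\<close>-periodic sequences in the closed hemisphere. At a
  maximizer \<open>q\<^sub>k\<^sub>+\<^sub>1 + q\<^sub>k\<^sub>-\<^sub>1 + h^2 N\<^sub>k\<close> is a positive multiple of \<open>q\<^sub>k\<close>, which gives a bound on the discrete
  velocity independent of \<open>n\<close>. By Tychonoff's theorem the discrete solutions cluster pointwise, and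
  every cluster point solves the differential equation.
\<close>

section \<open>Increments of sequences along a time grid\<close>

lemma norm_diff_int_le:
  fixes a :: "int \<Rightarrow> 'a::real_normed_vector"
  assumes "k \<le> m" and "\<And>i. k \<le> i \<Longrightarrow> i < m \<Longrightarrow> norm (a (i + 1) - a i) \<le> c"
  shows "norm (a m - a k) \<le> of_int (m - k) * c"
  using assms
proof (induction m rule: int_ge_induct)
  case base
  then show ?case by simp
next
  case (step m)
  have "norm (a (m + 1) - a k) \<le> norm (a (m + 1) - a m) + norm (a m - a k)"
    using norm_triangle_ineq[of "a (m + 1) - a m" "a m - a k"] by simp
  also have "\<dots> \<le> c + of_int (m - k) * c"
    using step by (intro add_mono) auto
  finally show ?case by (simp add: algebra_simps)
qed

text \<open>Subtracting the linear motion with velocity \<open>c\<close> leaves steps of size at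
  most \<open>h * e\<close>, and about \<open>\<bar>t - s\<bar> / h\<close> of them separate the two
  floors. Rounding \<open>s\<close> and \<open>t\<close> to the grid accounts for the term with
  \<open>h\<close>, and for the margin \<open>h\<close> in \<open>inc\<close>, since the floor of
  \<open>s\<close> may lie almost \<open>h\<close> before \<open>s\<close>.\<close>

lemma grid_increment_estimate:
  fixes z :: "int \<Rightarrow> 'a::real_normed_vector"
  assumes h: "0 < h" and e: "0 \<le> e"
    and inc: "\<And>i. \<bar>of_int i * h - s\<bar> \<le> \<bar>t - s\<bar> + h \<Longrightarrow> norm (z (i + 1) - z i - h *\<^sub>R c) \<le> h * e"
    and c: "norm c \<le> B"
  shows "norm (z \<lfloor>t / h\<rfloor> - z \<lfloor>s / h\<rfloor> - (t - s) *\<^sub>R c) \<le> e * \<bar>t - s\<bar> + h * (e + B)"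
proof -
  define k where "k = \<lfloor>s / h\<rfloor>"
  define m where "m = \<lfloor>t / h\<rfloor>"
  define a where "a i = z i - (of_int i * h) *\<^sub>R c" for i
  have floor: "of_int \<lfloor>x / h\<rfloor> * h \<le> x" "x < of_int \<lfloor>x / h\<rfloor> * h + h" for x
    using floor_divide_lower[OF h, of x] floor_divide_upper[OF h, of x] by (auto simp: algebra_simps)
  have k: "of_int k * h \<le> s" "s < of_int k * h + h" and m: "of_int m * h \<le> t" "t < of_int m * h + h"
    using floor[of s] floor[of t] by (auto simp: k_def m_def)
  have step: "norm (a (i + 1) - a i) \<le> h * e" if "min k m \<le> i" "i < max k m" for i
  proof -
    have "k \<le> i \<and> i \<le> m \<or> m \<le> i \<and> i \<le> k" using that by linarith
    then have "of_int k * h \<le> of_int i * h \<and> of_int i * h \<le> of_int m * h \<or>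
        of_int m * h \<le> of_int i * h \<and> of_int i * h \<le> of_int k * h"
      using h by simp
    then have "\<bar>of_int i * h - s\<bar> \<le> \<bar>t - s\<bar> + h"
      using k m h by linarith
    from inc[OF this] show ?thesis
      by (simp add: a_def algebra_simps)
  qed
  have "norm (a m - a k) \<le> \<bar>of_int (m - k)\<bar> * (h * e)"
  proof (cases "k \<le> m")
    case True
    then show ?thesis using norm_diff_int_le[of k m a "h * e"] step by (simp add: min_def max_def)
  next
    case False
    then show ?thesis using norm_diff_int_le[of m k a "h * e"] step
      by (simp add: min_def max_def norm_minus_commute)
  qed
  also have "\<dots> = \<bar>of_int (m - k) * h\<bar> * e"
    using h by (simp add: abs_mult)
  also have "\<dots> = \<bar>of_int m * h - of_int k * h\<bar> * e"
    by (simp add: left_diff_distrib)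
  also have "\<dots> \<le> (\<bar>t - s\<bar> + h) * e"
    using k m e by (intro mult_right_mono) auto
  finally have 1: "norm (a m - a k) \<le> (\<bar>t - s\<bar> + h) * e" .
  have "\<bar>of_int m * h - of_int k * h - (t - s)\<bar> * norm c \<le> h * B"
    using k m c h by (intro mult_mono) auto
  then have 2: "norm ((of_int m * h - of_int k * h - (t - s)) *\<^sub>R c) \<le> h * B"
    by simp
  have "z m - z k - (t - s) *\<^sub>R c = (a m - a k) + (of_int m * h - of_int k * h - (t - s)) *\<^sub>R c"
    by (simp add: a_def algebra_simps)
  then have "norm (z m - z k - (t - s) *\<^sub>R c) \<le> (\<bar>t - s\<bar> + h) * e + h * B"
    using 1 2 norm_triangle_mono by metis
  then show ?thesis by (simp add: k_def m_def algebra_simps)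
qed

section \<open>Pointwise cluster points and the limit of a difference scheme\<close>

text \<open>The first hypothesis says that \<open>x\<close> is a cluster point of \<open>F\<close>.
  Were \<open>x\<close> outside \<open>C\<close>, the complement of \<open>C\<close> would be a
  neighbourhood of \<open>x\<close> that \<open>F\<close> eventually avoids.\<close>

lemma inf_nhds_neq_bot_closed:
  assumes "inf (nhds x) F \<noteq> bot" and "eventually (\<lambda>y. y \<in> C) F" and "closed C"
  shows "x \<in> C"
proof (rule ccontr)
  assume "x \<notin> C"
  then have "eventually (\<lambda>y. y \<in> - C) (nhds x)"
    using assms(3) by (intro eventually_nhds_in_open) auto
  then have "eventually (\<lambda>_. False) (inf (nhds x) F)"
    using assms(2) unfolding eventually_inf by auto
  then show False using assms(1) by (simp add: eventually_False)
qed

text \<open>Tychonoff's theorem in type class form. It serves index type \<open>int\<close> for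
  chains and index type \<open>real\<close> for step functions of time.\<close>

lemma compact_PiE_UNIV:
  fixes S :: "'b::topological_space set"
  assumes "compact S"
  shows "compact {f :: 'a \<Rightarrow> 'b. \<forall>i. f i \<in> S}"
proof -
  have "compactin (product_topology (\<lambda>_. euclidean) UNIV) (PiE (UNIV :: 'a set) (\<lambda>_. S))"
    using assms by (simp add: compactin_PiE)
  moreover have "PiE (UNIV :: 'a set) (\<lambda>_. S) = {f. \<forall>i. f i \<in> S}" by auto
  ultimately show ?thesis by (simp add: euclidean_product_topology)
qed

lemma continuous_on_coordinate [continuous_intros]:
  "continuous_on A (\<lambda>f :: 'a \<Rightarrow> 'b::topological_space. f i)"
  by (rule continuous_on_subset[OF continuous_on_product_coordinates]) simp

text \<open>The schemes become step functions of real time with values in the compact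
  \<open>S\<close>, so they have a pointwise cluster point \<open>Z\<close>. Periodicity and the
  derivative estimate at \<open>s\<close> are closed conditions on the values at two times, so they
  pass to \<open>Z\<close>.\<close>

lemma difference_scheme_limit:
  fixes f :: "real \<Rightarrow> 'a::euclidean_space \<Rightarrow> 'a" and z :: "nat \<Rightarrow> int \<Rightarrow> 'a"
    and h \<epsilon> :: "nat \<Rightarrow> real" and m :: "nat \<Rightarrow> int"
  assumes f: "continuous_on UNIV (\<lambda>(t, y). f t y)"
    and S: "compact S" and zS: "\<And>n k. z n k \<in> S"
    and h: "\<And>n. 0 < h n" "h \<longlonglongrightarrow> 0" and \<epsilon>: "\<epsilon> \<longlonglongrightarrow> 0"
    and step: "\<And>n k. norm (z n (k + 1) - z n k - h n *\<^sub>R f (of_int k * h n) (z n k)) \<le> h n * \<epsilon> n"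
    and m: "\<And>n. of_int (m n) * h n = T" and per: "\<And>n k. z n (k + m n) = z n k"
  shows "\<exists>Z. (\<forall>t. (Z has_vector_derivative f t (Z t)) (at t)) \<and> (\<forall>t. Z t \<in> S) \<and> (\<forall>t. Z (t + T) = Z t)"
proof -
  define \<phi> where "\<phi> n t = z n \<lfloor>t / h n\<rfloor>" for n and t :: real
  have \<phi>S: "\<phi> n t \<in> S" for n t by (simp add: \<phi>_def zS)
  have "filtermap \<phi> sequentially \<noteq> bot" by (simp add: filtermap_bot_iff)
  moreover have "eventually (\<lambda>g. g \<in> {g. \<forall>t. g t \<in> S}) (filtermap \<phi> sequentially)"
    by (simp add: eventually_filtermap \<phi>S)
  ultimately obtain Z where ZS: "\<And>t. Z t \<in> S" and Z: "inf (nhds Z) (filtermap \<phi> sequentially) \<noteq> bot"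
    using compact_PiE_UNIV[OF S] unfolding compact_filter by blast
  \<comment> \<open>This rule replaces the choice of a convergent subsequence.\<close>
  have limit: "P Z" if "\<forall>\<^sub>F n in sequentially. P (\<phi> n)" "closed {g. P g}" for P
    using inf_nhds_neq_bot_closed[OF Z, of "{g. P g}"] that by (simp add: eventually_filtermap)
  have fs: "continuous_on UNIV (f s)" for s
  proof -
    have "continuous_on UNIV (\<lambda>y. (\<lambda>(t, y). f t y) (s, y))"
      by (rule continuous_on_compose2[OF f]) (auto intro!: continuous_intros)
    then show ?thesis by simp
  qed
  have \<phi>per: "\<phi> n (t + T) = \<phi> n t" for n t
  proof -
    have "(t + T) / h n = t / h n + of_int (m n)"
      using h(1)[of n] m[of n, symmetric] by (simp add: field_simps)
    then show ?thesis by (simp add: \<phi>_def per)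
  qed
  have "Z (t + T) = Z t" for t
    by (rule limit) (auto simp: \<phi>per intro!: closed_Collect_eq continuous_intros)
  moreover have "(Z has_vector_derivative f s (Z s)) (at s)" for s
    unfolding has_vector_derivative_def has_derivative_at_alt
  proof (intro conjI allI impI)
    fix e :: real assume e: "e > 0"
    define K where "K = {s - 1..s + 1} \<times> S"
    have K: "compact K" unfolding K_def by (intro compact_Times S) auto
    have "uniformly_continuous_on K (\<lambda>(t, y). f t y)"
      using f K by (intro compact_uniformly_continuous) (auto intro: continuous_on_subset)
    then obtain d where d: "d > 0"
      "\<And>p q. p \<in> K \<Longrightarrow> q \<in> K \<Longrightarrow> dist q p < d \<Longrightarrow> norm ((\<lambda>(t, y). f t y) q - (\<lambda>(t, y). f t y) p) < e / 2"
      unfolding uniformly_continuous_on_def dist_norm using e by (meson half_gt_zero)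
    have "compact ((\<lambda>(t, y). f t y) ` K)"
      using f K by (intro compact_continuous_image) (auto intro: continuous_on_subset)
    then obtain B where B: "B > 0" "\<And>p. p \<in> K \<Longrightarrow> norm ((\<lambda>(t, y). f t y) p) \<le> B"
      using compact_imp_bounded bounded_pos by (metis imageI)
    \<comment> \<open>If \<open>\<bar>t - s\<bar>\<close> and \<open>h n\<close> are below
      \<open>\<delta>\<close>, the grid times involved lie within \<open>2 * \<delta>\<close> of
      \<open>s\<close>, and the states there within \<open>3 * \<delta> * (B + 1)\<close> of
      \<open>\<phi> n s\<close>. The second bound makes the sum of both less than \<open>d\<close>;
      the bound \<open>1 / 4\<close> keeps all times inside \<open>K\<close>.\<close>
    define \<delta> where "\<delta> = min (1/4) (d / (8 * (B + 2)))"
    have \<delta>: "\<delta> > 0" using d(1) B(1) by (simp add: \<delta>_def)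
    have \<delta>4: "\<delta> \<le> 1 / 4" unfolding \<delta>_def by (rule min.cobounded1)
    have \<delta>d: "8 * \<delta> * (B + 2) \<le> d"
    proof -
      have "\<delta> \<le> d / (8 * (B + 2))" by (simp add: \<delta>_def)
      then show ?thesis using B(1) by (simp add: field_simps)
    qed
    \<comment> \<open>The slack \<open>\<eta>\<close> absorbs the rounding error
      \<open>h n * (e + B)\<close>, which tends to 0; it is removed after the passage to the
      limit.\<close>
    have bound: "norm (Z t - Z s - (t - s) *\<^sub>R f s (Z s)) \<le> e * \<bar>t - s\<bar> + \<eta>" if t: "\<bar>t - s\<bar> < \<delta>" and "\<eta> > 0" for t \<eta>
    proof -
      have "(\<lambda>n. h n * (e + B)) \<longlonglongrightarrow> 0 * (e + B)" by (intro tendsto_intros h)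
      then have "\<forall>\<^sub>F n in sequentially. h n * (e + B) < \<eta>" using \<open>\<eta> > 0\<close> by (auto dest: order_tendstoD(2))
      moreover have "\<forall>\<^sub>F n in sequentially. h n < \<delta>" using h(2) \<delta> by (rule order_tendstoD(2))
      moreover have "\<forall>\<^sub>F n in sequentially. \<epsilon> n < min 1 (e / 2)" by (rule order_tendstoD(2)[OF \<epsilon>]) (use e in simp)
      ultimately have "\<forall>\<^sub>F n in sequentially. norm (\<phi> n t - \<phi> n s - (t - s) *\<^sub>R f s (\<phi> n s)) \<le> e * \<bar>t - s\<bar> + \<eta>"
      proof eventually_elim
        case (elim n)
        have hn: "0 < h n" by (rule h)
        have inK: "(of_int i * h n, z n i) \<in> K" if "\<bar>of_int i * h n - s\<bar> \<le> 1" for i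
          using that zS by (auto simp: K_def)
        \<comment> \<open>Velocity 0 first gives a Lipschitz bound, with constant
          \<open>B + 1\<close> because \<open>\<epsilon> n < 1\<close>. It keeps the states near
          \<open>\<phi> n s\<close>, so that uniform continuity allows comparison with the fixed
          velocity \<open>f s (\<phi> n s)\<close> in \<open>fine\<close>.\<close>
        have coarse: "norm (z n (i + 1) - z n i - h n *\<^sub>R 0) \<le> h n * (B + 1)" if "\<bar>of_int i * h n - s\<bar> \<le> 1" for i
        proof -
          have "norm (h n *\<^sub>R f (of_int i * h n) (z n i)) \<le> h n * B"
            using B(2)[OF inK[OF that]] hn by simp
          moreover have "h n * \<epsilon> n \<le> h n * 1" using elim hn by (intro mult_left_mono) auto
          ultimately have "norm ((z n (i + 1) - z n i - h n *\<^sub>R f (of_int i * h n) (z n i)) + h n *\<^sub>R f (of_int i * h n) (z n i)) \<le> h n * 1 + h n * B"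
            using step[of n i] by (intro norm_triangle_mono) linarith+
          then show ?thesis by (simp add: algebra_simps)
        qed
        have fine: "norm (z n (i + 1) - z n i - h n *\<^sub>R f s (\<phi> n s)) \<le> h n * e"
          if i: "\<bar>of_int i * h n - s\<bar> \<le> \<bar>t - s\<bar> + h n" for i
        proof -
          have r: "\<bar>of_int i * h n - s\<bar> < 2 * \<delta>" "2 * \<delta> \<le> 1/2" "h n < 1/4"
            using i t elim \<delta>4 by linarith+
          have "norm (z n \<lfloor>of_int i * h n / h n\<rfloor> - z n \<lfloor>s / h n\<rfloor> - (of_int i * h n - s) *\<^sub>R 0)
            \<le> (B + 1) * \<bar>of_int i * h n - s\<bar> + h n * ((B + 1) + 0)"
          proof (rule grid_increment_estimate[OF hn])
            show "norm (z n (j + 1) - z n j - h n *\<^sub>R 0) \<le> h n * (B + 1)"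
              if "\<bar>of_int j * h n - s\<bar> \<le> \<bar>of_int i * h n - s\<bar> + h n" for j
              using r that by (intro coarse) linarith
          qed (use B in auto)
          also have "\<dots> \<le> (B + 1) * (2 * \<delta>) + \<delta> * (B + 1)"
            using r elim B(1) by (intro add_mono mult_left_mono) (auto intro!: mult_right_mono)
          finally have "norm (z n i - \<phi> n s) \<le> 3 * \<delta> * (B + 1)"
            using hn by (simp add: \<phi>_def algebra_simps)
          then have "dist (of_int i * h n, z n i) (s, \<phi> n s) \<le> 2 * \<delta> + 3 * \<delta> * (B + 1)"
            using r unfolding dist_Pair_Pair
            by (intro order_trans[OF sqrt_sum_squares_le_sum]) (auto simp: dist_norm)
          also have "\<dots> = 8 * \<delta> * (B + 2) - \<delta> * (5 * B + 11)" by (simp add: algebra_simps)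
          also have "\<dots> < 8 * \<delta> * (B + 2)" using \<delta> B(1) by simp
          also have "\<dots> \<le> d" by (rule \<delta>d)
          finally have "norm (f (of_int i * h n) (z n i) - f s (\<phi> n s)) < e / 2"
            using d(2)[of "(s, \<phi> n s)" "(of_int i * h n, z n i)"] inK[of i] r \<phi>S by (auto simp: K_def)
          then have "norm (h n *\<^sub>R (f (of_int i * h n) (z n i) - f s (\<phi> n s))) \<le> h n * (e / 2)"
            using hn by simp
          moreover have "h n * \<epsilon> n \<le> h n * (e / 2)" using elim hn by (intro mult_left_mono) auto
          ultimately have "norm ((z n (i + 1) - z n i - h n *\<^sub>R f (of_int i * h n) (z n i))
              + h n *\<^sub>R (f (of_int i * h n) (z n i) - f s (\<phi> n s))) \<le> h n * (e / 2) + h n * (e / 2)"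
            using step[of n i] by (intro norm_triangle_mono) linarith+
          then show ?thesis by (simp add: algebra_simps)
        qed
        have "norm (\<phi> n t - \<phi> n s - (t - s) *\<^sub>R f s (\<phi> n s)) \<le> e * \<bar>t - s\<bar> + h n * (e + B)"
          unfolding \<phi>_def
        proof (rule grid_increment_estimate[OF hn])
          show "norm (f s (z n \<lfloor>s / h n\<rfloor>)) \<le> B"
            using B(2)[of "(s, \<phi> n s)"] \<phi>S by (auto simp: K_def \<phi>_def)
        qed (use e fine in \<open>auto simp: \<phi>_def\<close>)
        then show ?case using elim by linarith
      qed
      then show ?thesis
        by (rule limit[where P = "\<lambda>g. norm (g t - g s - (t - s) *\<^sub>R f s (g s)) \<le> e * \<bar>t - s\<bar> + \<eta>"])
          (intro closed_Collect_le continuous_intros continuous_on_compose2[OF fs], auto)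
    qed
    have "norm (Z t - Z s - (t - s) *\<^sub>R f s (Z s)) \<le> e * norm (t - s)" if "norm (t - s) < \<delta>" for t
    proof (rule field_le_epsilon)
      fix \<eta> :: real assume "\<eta> > 0"
      then show "norm (Z t - Z s - (t - s) *\<^sub>R f s (Z s)) \<le> e * norm (t - s) + \<eta>"
        using bound[of t \<eta>] that by (simp only: real_norm_def)
    qed
    then show "\<exists>d>0. \<forall>t. norm (t - s) < d \<longrightarrow> norm (Z t - Z s - (t - s) *\<^sub>R f s (Z s)) \<le> e * norm (t - s)"
      using \<delta> by blast
  qed (rule bounded_linear_scaleR_left)
  ultimately show ?thesis using ZS by blast
qed

section \<open>Periodic integer sequences\<close>

lemma periodic_int_mult:
  fixes g :: "int \<Rightarrow> 'a"
  assumes "\<And>k. g (k + n) = g k"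
  shows "g (k + n * m) = g k"
proof (induction m rule: int_induct[where k = 0])
  case base
  then show ?case by simp
next
  case (step1 i)
  then show ?case using assms[of "k + n * i"] by (simp add: algebra_simps)
next
  case (step2 i)
  then show ?case using assms[of "k + n * (i - 1)"] by (simp add: algebra_simps)
qed

lemma periodic_int_representative:
  fixes g :: "int \<Rightarrow> 'a" and n :: nat
  assumes "\<And>k. g (k + int n) = g k" and "0 < n"
  obtains i where "i < n" "g (a + int i) = g k"
proof
  show "nat ((k - a) mod int n) < n" using assms(2) by (simp add: nat_less_iff)
  have "a + int (nat ((k - a) mod int n)) = k + int n * (- ((k - a) div int n))"
    using assms(2) minus_mult_div_eq_mod[of "k - a" "int n"] by simp
  then show "g (a + int (nat ((k - a) mod int n))) = g k"
    using periodic_int_mult[of g "int n", OF assms(1)] by metis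
qed

lemma sum_periodic_shift:
  fixes g :: "int \<Rightarrow> 'a::ab_group_add"
  assumes "\<And>k. g (k + int n) = g k"
  shows "(\<Sum>i<n. g (int i + 1)) = (\<Sum>i<n. g (int i))"
proof -
  have "(\<Sum>i<n. g (int (Suc i)) - g (int i)) = g (int n) - g (int 0)"
    by (rule sum_lessThan_telescope)
  then show ?thesis using assms[of 0] by (simp add: sum_subtractf add.commute)
qed

text \<open>By the mean square bound some term is at most \<open>b\<close>. Every value recurs less
  than one period after that term, and each step on the way adds at most \<open>c\<close>.\<close>

lemma periodic_lipschitz_le:
  fixes a :: "int \<Rightarrow> real" and n :: nat
  assumes per: "\<And>k. a (k + int n) = a k" and n: "0 < n"
    and lip: "\<And>k. a (k + 1) - a k \<le> c" and c: "0 \<le> c"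
    and nn: "\<And>k. 0 \<le> a k" and avg: "(\<Sum>i<n. (a (int i))\<^sup>2) \<le> of_nat n * b\<^sup>2" and b: "0 \<le> b"
  shows "a k \<le> b + of_nat n * c"
proof -
  have "\<exists>j<n. a (int j) \<le> b"
  proof (rule ccontr)
    assume "\<not> ?thesis"
    then have "b\<^sup>2 < (a (int j))\<^sup>2" if "j < n" for j
      using that b by (intro power_strict_mono) auto
    then have "(\<Sum>i<n. b\<^sup>2) < (\<Sum>i<n. (a (int i))\<^sup>2)"
      using n by (intro sum_strict_mono) auto
    then show False using avg by simp
  qed
  then obtain j where j: "a (int j) \<le> b" by blast
  obtain i where i: "i < n" "a (int j + int i) = a k"
    using periodic_int_representative[of a n, OF per n] by metis
  have "a (int j + int i) \<le> a (int j) + of_nat i * c" for i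
  proof (induction i)
    case (Suc i)
    then show ?case using lip[of "int j + int i"] by (simp add: algebra_simps)
  qed simp
  from this[of i] have "a k \<le> b + of_nat i * c" using i j by simp
  also have "\<dots> \<le> b + of_nat n * c" using i c by (simp add: mult_right_mono)
  finally show ?thesis .
qed

section \<open>Maximizing chains on the hemisphere and their speed\<close>

lemma compact_hemisphere: "compact {x :: 'a::euclidean_space. norm x = 1 \<and> x \<bullet> e \<ge> 0}"
proof -
  have "compact (sphere 0 1 \<inter> {x :: 'a. x \<bullet> e \<ge> 0})"
    by (intro compact_Int_closed closed_Collect_le continuous_intros) auto
  then show ?thesis by (simp add: sphere_def Int_def)
qed

text \<open>As a function of a single point \<open>q j\<close> the action is affine with gradient
  \<open>v j\<close>. Since \<open>v j \<bullet> e > 0\<close>, the normalized \<open>v j\<close>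
  lies in the hemisphere and competes with \<open>q j\<close>, so equality in Cauchy-Schwarz makes
  the two parallel. The lower bound on the action comes from the constant chain
  \<open>e\<close>.\<close>

lemma discrete_chain_maximizer:
  fixes b :: "int \<Rightarrow> 'a::euclidean_space" and n :: nat
  assumes n: "2 \<le> n" and per: "\<And>k. b (k + int n) = b k"
    and e: "norm e = 1" and pos: "\<And>k. b k \<bullet> e > 0"
  obtains q where "\<And>k. norm (q k) = 1" "\<And>k. q k \<bullet> e \<ge> 0" "\<And>k. q (k + int n) = q k"
    "\<And>k. q (k + 1) + q (k - 1) + b k = norm (q (k + 1) + q (k - 1) + b k) *\<^sub>R q k"
    "(\<Sum>i<n. q (int i) \<bullet> q (int i + 1) + b (int i) \<bullet> q (int i)) \<ge> of_nat n"
proof -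
  define H where "H = {x :: 'a. norm x = 1 \<and> x \<bullet> e \<ge> 0}"
  define K where "K = {q :: int \<Rightarrow> 'a. \<forall>k. q k \<in> H} \<inter> {q. \<forall>k. q (k + int n) = q k}"
  define \<Phi> where "\<Phi> q = (\<Sum>i<n. q (int i) \<bullet> q (int i + 1) + b (int i) \<bullet> q (int i))" for q :: "int \<Rightarrow> 'a"
  have "compact H" unfolding H_def by (rule compact_hemisphere)
  then have "compact K" unfolding K_def
    by (intro compact_Int_closed compact_PiE_UNIV closed_Collect_all closed_Collect_eq continuous_intros)
  moreover have eK: "(\<lambda>_. e) \<in> K"
    using e by (simp add: K_def H_def)
  moreover have "continuous_on K \<Phi>" unfolding \<Phi>_def by (intro continuous_intros)
  ultimately obtain q where q: "q \<in> K" and max: "\<And>r. r \<in> K \<Longrightarrow> \<Phi> r \<le> \<Phi> q"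
    using continuous_attains_sup[of K \<Phi>] by blast
  have qH: "q k \<in> H" and qper: "q (k + int n) = q k" for k using q by (auto simp: K_def)
  define v where "v k = q (k + 1) + q (k - 1) + b k" for k
  have vper: "v (k + int n) = v k" for k
    using qper[of "k + 1"] qper[of "k - 1"] per[of k] by (simp add: v_def algebra_simps)
  have variation: "u \<bullet> v j \<le> q j \<bullet> v j" if u: "u \<in> H" for u j
  proof -
    \<comment> \<open>The point \<open>q j\<close> and all its periodic copies are moved to
      \<open>u\<close>, which keeps the chain periodic.\<close>
    define d where "d k = (if int n dvd k - j then u - q j else 0)" for k
    have dper: "d (k + int n) = d k" for k
    proof -
      have "k + int n - j = (k - j) + int n" by simp
      then show ?thesis unfolding d_def by (simp only: dvd_add_triv_right_iff)
    qed
    have qd: "q k + d k = (if int n dvd k - j then u else q k)" for k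
    proof -
      have "q k = q j" if dvd: "int n dvd k - j"
      proof -
        obtain c where "k - j = int n * c" using dvd by (elim dvdE)
        then have "k = j + int n * c" by simp
        then show ?thesis using periodic_int_mult[of q "int n", OF qper] by simp
      qed
      then show ?thesis by (simp add: d_def)
    qed
    have "(\<lambda>k. q k + d k) \<in> K"
      using qH u by (simp add: K_def qper dper qd) (metis dper qd qper)
    then have "\<Phi> (\<lambda>k. q k + d k) \<le> \<Phi> q" by (rule max)
    moreover have "\<Phi> (\<lambda>k. q k + d k) - \<Phi> q = (\<Sum>i<n. d (int i) \<bullet> v (int i))"
    proof -
      \<comment> \<open>As \<open>2 \<le> n\<close>, no two moved points are adjacent, so the action
        changes by exactly its linear part.\<close>
      have dd: "d k \<bullet> d (k + 1) = 0" for k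
      proof (rule ccontr)
        assume "d k \<bullet> d (k + 1) \<noteq> 0"
        then have "int n dvd k - j" "int n dvd k + 1 - j" by (auto simp: d_def split: if_splits)
        then have "int n dvd (k + 1 - j) - (k - j)" by (rule dvd_diff[rotated])
        then show False using n by simp
      qed
      have "(\<Sum>i<n. q (int i) \<bullet> d (int i + 1)) = (\<Sum>i<n. q (int i - 1) \<bullet> d (int i))"
      proof -
        have "q (k + int n - 1) \<bullet> d (k + int n) = q (k - 1) \<bullet> d k" for k
          using qper[of "k - 1"] dper[of k] by (simp add: algebra_simps)
        then show ?thesis using sum_periodic_shift[of "\<lambda>k. q (k - 1) \<bullet> d k" n] by simp
      qed
      then have "(\<Sum>i<n. d (int i) \<bullet> v (int i)) = (\<Sum>i<n. d (int i) \<bullet> q (int i + 1) + q (int i) \<bullet> d (int i + 1) + b (int i) \<bullet> d (int i))"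
        by (simp add: v_def inner_add_right sum.distrib inner_commute)
      also have "\<dots> = \<Phi> (\<lambda>k. q k + d k) - \<Phi> q"
        unfolding \<Phi>_def sum_subtractf[symmetric] using dd
        by (intro sum.cong) (auto simp: inner_add_left inner_add_right inner_commute)
      finally show ?thesis by simp
    qed
    moreover have "(\<Sum>i<n. d (int i) \<bullet> v (int i)) = (u - q j) \<bullet> v j"
    proof -
      have n0: "0 < n" using n by simp
      \<comment> \<open>The pair yields one representative of \<open>j\<close> in the summation
        range that serves both \<open>d\<close> and \<open>v\<close>. When \<open>u\<close> differs
        from \<open>q j\<close>, it is the only index there with \<open>d\<close> nonzero.\<close>
      obtain i where i: "i < n" "(d (int i), v (int i)) = (d j, v j)"
        using periodic_int_representative[of "\<lambda>k. (d k, v k)" n 0 j] dper vper n0 by auto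
      show ?thesis
      proof (cases "u = q j")
        case True
        then have "d k = 0" for k by (simp add: d_def)
        then show ?thesis using True by simp
      next
        case False
        have "d (int l) = 0" if "l < n" "l \<noteq> i" for l
        proof (rule ccontr)
          assume "d (int l) \<noteq> 0"
          then have "int n dvd int l - j" by (auto simp: d_def split: if_splits)
          moreover have "int n dvd int i - j" using i False by (auto simp: d_def split: if_splits)
          ultimately have "int n dvd (int l - j) - (int i - j)" by (rule dvd_diff)
          then have "int l mod int n = int i mod int n" by (simp add: mod_eq_dvd_iff)
          then show False using that i by simp
        qed
        then have "(\<Sum>l<n. d (int l) \<bullet> v (int l)) = (\<Sum>l<n. if l = i then d (int l) \<bullet> v (int l) else 0)"
          by (intro sum.cong) auto
        then show ?thesis using i by (simp add: d_def)
      qed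
    qed
    ultimately show ?thesis by (simp add: inner_diff_left)
  qed
  have EL: "v k = norm (v k) *\<^sub>R q k" for k
  proof -
    have ve: "v k \<bullet> e > 0"
      using pos[of k] qH[of "k + 1"] qH[of "k - 1"] by (simp add: v_def H_def inner_add_left)
    then have v0: "v k \<noteq> 0" by auto
    have "v k /\<^sub>R norm (v k) \<in> H" using ve v0 by (simp add: H_def divide_simps)
    from variation[OF this, of k] have "norm (v k) \<le> q k \<bullet> v k"
      using v0 by (simp add: dot_square_norm power2_eq_square mult.assoc[symmetric])
    moreover have "norm (q k) = 1" using qH by (simp add: H_def)
    ultimately have "q k \<bullet> v k = norm (q k) * norm (v k)"
      using norm_cauchy_schwarz[of "q k" "v k"] by simp
    then have "norm (q k) *\<^sub>R v k = norm (v k) *\<^sub>R q k" by (simp only: norm_cauchy_schwarz_eq)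
    then show ?thesis using \<open>norm (q k) = 1\<close> by simp
  qed
  have "of_nat n \<le> \<Phi> (\<lambda>_. e)"
  proof -
    have "(\<Sum>i<n. 1) \<le> \<Phi> (\<lambda>_. e)" unfolding \<Phi>_def
      using pos e by (intro sum_mono) (simp add: dot_square_norm less_imp_le)
    then show ?thesis by simp
  qed
  also have "\<dots> \<le> \<Phi> q" by (rule max[OF eK])
  finally have "of_nat n \<le> \<Phi> q" .
  show thesis
    by (rule that[of q]) (use qH qper EL \<open>of_nat n \<le> \<Phi> q\<close> in \<open>auto simp: H_def v_def \<Phi>_def\<close>)
qed

text \<open>A maximal chain has bounded discrete speed: comparing it with the constant chain bounds the
  mean square speed, and the Euler-Lagrange equation bounds the variation of the speed.\<close>

lemma discrete_chain_speed_bound: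
  fixes q N :: "int \<Rightarrow> 'a::euclidean_space" and n :: nat and h C :: real
  defines "D \<equiv> \<lambda>k. q k - q (k - 1)"
  assumes n: "0 < n" and h: "0 < h" and q: "\<And>k. norm (q k) = 1" and per: "\<And>k. q (k + int n) = q k"
    and N: "\<And>k. norm (N k) \<le> C"
    and EL: "\<And>k. q (k + 1) + q (k - 1) + h\<^sup>2 *\<^sub>R N k = norm (q (k + 1) + q (k - 1) + h\<^sup>2 *\<^sub>R N k) *\<^sub>R q k"
    and energy: "(\<Sum>i<n. q (int i) \<bullet> q (int i + 1) + (h\<^sup>2 *\<^sub>R N (int i)) \<bullet> q (int i)) \<ge> of_nat n"
    and small: "2 * (of_nat n * h\<^sup>2 * C) + h\<^sup>2 * C \<le> 1"
  shows "norm (D k) \<le> h * (sqrt (2 * C) + 2 * (of_nat n * h) * C)"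
    and "D (k + 1) - D k = h\<^sup>2 *\<^sub>R ((N k \<bullet> q k) *\<^sub>R q k - N k) - (((norm (D (k + 1)))\<^sup>2 + (norm (D k))\<^sup>2) / 2) *\<^sub>R q k"
proof -
  have C: "0 \<le> C" using N[of 0] norm_ge_zero order_trans by blast
  have qq: "q k \<bullet> q k = 1" for k using q[of k] by (simp add: dot_square_norm)
  have Dsq: "(norm (D k))\<^sup>2 = 2 - 2 * (q (k - 1) \<bullet> q k)" for k
    unfolding power2_norm_eq_inner by (simp add: D_def inner_diff inner_commute qq)
  \<comment> \<open>This is the Lagrange multiplier of the constraint at \<open>q k\<close>; pairing
    the Euler-Lagrange equation with \<open>q k\<close> expresses it through the speeds.\<close>
  define \<mu> where "\<mu> k = norm (q (k + 1) + q (k - 1) + h\<^sup>2 *\<^sub>R N k)" for k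
  have EL': "q (k + 1) + q (k - 1) + h\<^sup>2 *\<^sub>R N k = \<mu> k *\<^sub>R q k" for k
    unfolding \<mu>_def by (rule EL)
  have \<mu>: "\<mu> k = 2 - ((norm (D (k + 1)))\<^sup>2 + (norm (D k))\<^sup>2) / 2 + h\<^sup>2 * (N k \<bullet> q k)" for k
  proof -
    have "\<mu> k = (q (k + 1) + q (k - 1) + h\<^sup>2 *\<^sub>R N k) \<bullet> q k" using EL'[of k] qq[of k] by simp
    then show ?thesis unfolding Dsq by (simp add: inner_add inner_commute[of _ "q k"] field_simps)
  qed
  show 2: "D (k + 1) - D k = h\<^sup>2 *\<^sub>R ((N k \<bullet> q k) *\<^sub>R q k - N k) - (((norm (D (k + 1)))\<^sup>2 + (norm (D k))\<^sup>2) / 2) *\<^sub>R q k" for k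
  proof -
    have "D (k + 1) - D k = (q (k + 1) + q (k - 1) + h\<^sup>2 *\<^sub>R N k) - h\<^sup>2 *\<^sub>R N k - 2 *\<^sub>R q k"
      by (simp add: D_def scaleR_2)
    also have "\<dots> = (\<mu> k - 2) *\<^sub>R q k - h\<^sup>2 *\<^sub>R N k"
      unfolding EL' by (simp add: scaleR_diff_left)
    finally show ?thesis unfolding \<mu> by (simp add: algebra_simps)
  qed
  have Nq: "\<bar>N k \<bullet> q k\<bar> \<le> C" for k
    using Cauchy_Schwarz_ineq2[of "N k" "q k"] q[of k] N[of k] by simp
  have Dper: "D (k + int n) = D k" for k
    using per[of k] per[of "k - 1"] by (simp add: D_def algebra_simps)
  \<comment> \<open>On the sphere \<open>1 - q i \<bullet> q (i + 1)\<close> is half the squared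
    chord, so the lower bound on the action turns into an upper bound on the sum of squared
    chords.\<close>
  have sumD: "(\<Sum>i<n. (norm (D (int i)))\<^sup>2) \<le> 2 * (of_nat n * h\<^sup>2 * C)"
  proof -
    have "(\<Sum>i<n. (norm (D (int i)))\<^sup>2) = (\<Sum>i<n. (norm (D (int i + 1)))\<^sup>2)"
      using sum_periodic_shift[of "\<lambda>k. (norm (D k))\<^sup>2" n] Dper by simp
    also have "\<dots> = 2 * of_nat n - 2 * (\<Sum>i<n. q (int i) \<bullet> q (int i + 1))"
      unfolding Dsq by (simp add: sum_subtractf sum_distrib_left)
    also have "\<dots> \<le> 2 * (\<Sum>i<n. (h\<^sup>2 *\<^sub>R N (int i)) \<bullet> q (int i))"
      using energy by (simp add: sum.distrib)
    also have "(\<Sum>i<n. (h\<^sup>2 *\<^sub>R N (int i)) \<bullet> q (int i)) \<le> (\<Sum>i<n. h\<^sup>2 * C)"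
      using Nq by (intro sum_mono) (auto intro!: mult_left_mono simp: abs_le_iff)
    finally show ?thesis by simp
  qed
  \<comment> \<open>Bounding one term by the whole sum only gives order \<open>sqrt h\<close> when
    \<open>of_nat n * h\<close> is fixed, but with \<open>small\<close> this ensures
    \<open>\<mu> k \<ge> 1\<close>.\<close>
  have Dle: "(norm (D k))\<^sup>2 \<le> 2 * (of_nat n * h\<^sup>2 * C)" for k
  proof -
    obtain i where i: "i < n" "D (0 + int i) = D k"
      using periodic_int_representative[of D n, OF Dper n] by metis
    have "(norm (D (int i)))\<^sup>2 \<le> (\<Sum>i<n. (norm (D (int i)))\<^sup>2)"
      using i by (intro member_le_sum) auto
    then show ?thesis using i sumD by simp
  qed
  have \<mu>1: "1 \<le> \<mu> k" for k
  proof -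
    have "h\<^sup>2 * (- C) \<le> h\<^sup>2 * (N k \<bullet> q k)" using Nq[of k] by (intro mult_left_mono) (auto simp: abs_le_iff)
    then have "- (h\<^sup>2 * C) \<le> h\<^sup>2 * (N k \<bullet> q k)" by simp
    moreover have "((norm (D (k + 1)))\<^sup>2 + (norm (D k))\<^sup>2) / 2 \<le> 2 * (of_nat n * h\<^sup>2 * C)"
      using add_mono[OF Dle[of "k + 1"] Dle[of k]] by (simp add: mult_ac)
    ultimately show ?thesis unfolding \<mu> using small by argo
  qed
  \<comment> \<open>A discrete energy balance: pair the Euler-Lagrange equation with
    \<open>q (k - 1) - q (k + 1)\<close>. The chain terms on the left cancel by unit length, only
    the force remains, and \<open>\<mu> k \<ge> 1\<close> allows division by
    \<open>u + v\<close>.\<close>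
  have lip: "norm (D (k + 1)) - norm (D k) \<le> 2 * h\<^sup>2 * C" for k
  proof (rule ccontr)
    define u where "u = norm (D (k + 1))"
    define v where "v = norm (D k)"
    assume "\<not> ?thesis"
    then have gt: "u - v > 2 * h\<^sup>2 * C" by (simp add: u_def v_def)
    moreover have hC: "0 \<le> 2 * h\<^sup>2 * C" using C by simp
    moreover have "0 \<le> u" "0 \<le> v" by (auto simp: u_def v_def)
    ultimately have pos: "0 < u + v" "u - v > 0" by linarith+
    have "\<mu> k * (u\<^sup>2 - v\<^sup>2) = 2 * ((\<mu> k *\<^sub>R q k) \<bullet> (q (k - 1) - q (k + 1)))"
      unfolding u_def v_def Dsq by (simp add: inner_diff_right inner_commute algebra_simps)
    also have "\<dots> = - 2 * h\<^sup>2 * (N k \<bullet> (D (k + 1) + D k))"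
      unfolding EL'[symmetric] D_def by (simp add: inner_diff inner_add inner_commute qq algebra_simps)
    also have "\<dots> \<le> 2 * h\<^sup>2 * (C * (u + v))"
    proof -
      have "\<bar>N k \<bullet> (D (k + 1) + D k)\<bar> \<le> norm (N k) * norm (D (k + 1) + D k)"
        by (rule Cauchy_Schwarz_ineq2)
      also have "\<dots> \<le> C * (u + v)"
        unfolding u_def v_def using N[of k] C by (intro mult_mono norm_triangle_ineq) auto
      finally have "- (N k \<bullet> (D (k + 1) + D k)) \<le> C * (u + v)" by linarith
      then have "2 * h\<^sup>2 * (- (N k \<bullet> (D (k + 1) + D k))) \<le> 2 * h\<^sup>2 * (C * (u + v))"
        by (intro mult_left_mono) auto
      then show ?thesis by simp
    qed
    finally have "\<mu> k * (u\<^sup>2 - v\<^sup>2) \<le> 2 * h\<^sup>2 * C * (u + v)" by simp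
    moreover have "1 * (u\<^sup>2 - v\<^sup>2) \<le> \<mu> k * (u\<^sup>2 - v\<^sup>2)"
      using \<mu>1[of k] pos by (intro mult_right_mono) (auto simp: power2_eq_square square_diff_square_factored)
    ultimately have "(u - v) * (u + v) \<le> 2 * h\<^sup>2 * C * (u + v)"
      by (simp add: power2_eq_square algebra_simps)
    then show False using pos gt by simp
  qed
  have "norm (D k) \<le> h * sqrt (2 * C) + of_nat n * (2 * h\<^sup>2 * C)"
  proof (rule periodic_lipschitz_le[where a = "\<lambda>k. norm (D k)"])
    show "(\<Sum>i<n. (norm (D (int i)))\<^sup>2) \<le> of_nat n * (h * sqrt (2 * C))\<^sup>2"
      using sumD C by (simp add: power_mult_distrib algebra_simps)
  qed (use n Dper lip C h in auto)
  then show "norm (D k) \<le> h * (sqrt (2 * C) + 2 * (of_nat n * h) * C)"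
    by (simp add: power2_eq_square algebra_simps)
qed

section \<open>The chain as a difference scheme in phase space\<close>

text \<open>The second order equation as a first order system for position and velocity, defined and
  continuous on the whole ambient space rather than on the tangent bundle.\<close>

definition sphere_field :: "(real \<Rightarrow> 'a::euclidean_space) \<Rightarrow> real \<Rightarrow> 'a \<times> 'a \<Rightarrow> 'a \<times> 'a" where
  "sphere_field N t z = (snd z, (N t \<bullet> fst z - (norm (snd z))\<^sup>2) *\<^sub>R fst z - N t)"

text \<open>Tangency of the velocity is not imposed, because a chord divided by the time step is in
  general not tangent to the sphere.\<close>

definition hemisphere_phase :: "'a::euclidean_space \<Rightarrow> real \<Rightarrow> ('a \<times> 'a) set" where
  "hemisphere_phase e V = {x. norm x = 1 \<and> x \<bullet> e \<ge> 0} \<times> cball 0 V"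

text \<open>The velocity is the backward difference quotient of a maximizing chain with force
  \<open>h\<^sup>2 *\<^sub>R N\<close>. It is bounded by \<open>V\<close> and changes by at most
  \<open>h * (2 * C + V\<^sup>2)\<close> per step, so the defect against an explicit Euler step is
  of second order in \<open>h\<close>.\<close>

lemma hemisphere_difference_scheme:
  fixes N :: "real \<Rightarrow> 'a::euclidean_space" and n :: nat and T C :: real
  defines "h \<equiv> T / of_nat n" and "V \<equiv> sqrt (2 * C) + 2 * T * C"
  assumes n: "2 \<le> n" and T: "T > 0" and per: "\<And>t. N (t + T) = N t"
    and e: "norm e = 1" and pos: "\<And>t. N t \<bullet> e > 0" and C: "\<And>t. norm (N t) \<le> C"
    and small: "2 * T * C * h + h\<^sup>2 * C \<le> 1"
  shows "\<exists>z :: int \<Rightarrow> 'a \<times> 'a. (\<forall>k. z k \<in> hemisphere_phase e V) \<and> (\<forall>k. z (k + int n) = z k) \<and>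
    (\<forall>k. norm (z (k + 1) - z k - h *\<^sub>R sphere_field N (of_int k * h) (z k)) \<le> h * (h * ((2 * C + V\<^sup>2) * (1 + V))))"
proof -
  have h: "h > 0" using n T by (simp add: h_def)
  have nh: "of_nat n * h = T" using n by (simp add: h_def)
  have C0: "0 \<le> C" using C[of 0] norm_ge_zero order_trans by blast
  define M where "M k = N (of_int k * h)" for k :: int
  have "of_int (k + int n) * h = of_int k * h + T" for k
    using nh by (simp add: algebra_simps)
  then have "M (k + int n) = M k" for k
    using per by (simp add: M_def)
  then obtain q where q: "\<And>k. norm (q k) = 1" "\<And>k. q k \<bullet> e \<ge> 0" and qper: "\<And>k. q (k + int n) = q k"
    and EL: "\<And>k. q (k + 1) + q (k - 1) + h\<^sup>2 *\<^sub>R M k = norm (q (k + 1) + q (k - 1) + h\<^sup>2 *\<^sub>R M k) *\<^sub>R q k"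
    and energy: "(\<Sum>i<n. q (int i) \<bullet> q (int i + 1) + (h\<^sup>2 *\<^sub>R M (int i)) \<bullet> q (int i)) \<ge> of_nat n"
    using discrete_chain_maximizer[of n "\<lambda>k. h\<^sup>2 *\<^sub>R M k" e] n e pos h by (auto simp: M_def)
  have "of_nat n * h\<^sup>2 = T * h" using nh by (simp add: power2_eq_square flip: mult.assoc)
  then have small': "2 * (of_nat n * h\<^sup>2 * C) + h\<^sup>2 * C \<le> 1" using small by (simp add: algebra_simps)
  have n0: "0 < n" using n by simp
  have MC: "norm (M k) \<le> C" for k by (simp add: M_def C)
  define D where "D k = q k - q (k - 1)" for k
  define p where "p k = D k /\<^sub>R h" for k
  have D: "D k = h *\<^sub>R p k" for k using h by (simp add: p_def)
  have "norm (D k) \<le> h * (sqrt (2 * C) + 2 * (of_nat n * h) * C)" for k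
    unfolding D_def by (rule discrete_chain_speed_bound[OF n0 h q(1) qper MC EL energy small'])
  then have "h * norm (p k) \<le> h * V" for k using h by (simp add: D nh V_def)
  then have pV: "norm (p k) \<le> V" for k using h by simp
  have V0: "0 \<le> V" using pV[of 0] norm_ge_zero order_trans by blast
  have dp: "p (k + 1) - p k = h *\<^sub>R ((M k \<bullet> q k - ((norm (p (k + 1)))\<^sup>2 + (norm (p k))\<^sup>2) / 2) *\<^sub>R q k - M k)" for k
  proof -
    have "h *\<^sub>R (p (k + 1) - p k) = D (k + 1) - D k" by (simp add: D scaleR_diff_right)
    also have "\<dots> = h\<^sup>2 *\<^sub>R ((M k \<bullet> q k) *\<^sub>R q k - M k) - (((norm (D (k + 1)))\<^sup>2 + (norm (D k))\<^sup>2) / 2) *\<^sub>R q k"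
      unfolding D_def by (rule discrete_chain_speed_bound[OF n0 h q(1) qper MC EL energy small'])
    also have "\<dots> = h *\<^sub>R (h *\<^sub>R ((M k \<bullet> q k - ((norm (p (k + 1)))\<^sup>2 + (norm (p k))\<^sup>2) / 2) *\<^sub>R q k - M k))"
      unfolding D norm_scaleR real_norm_def abs_of_pos[OF h] by (simp add: power_mult_distrib algebra_simps power2_eq_square add_divide_distrib)
    finally show ?thesis using h by (simp only: scaleR_cancel_left) simp
  qed
  have dp_le: "norm (p (k + 1) - p k) \<le> h * (2 * C + V\<^sup>2)" for k
  proof -
    have "\<bar>M k \<bullet> q k\<bar> \<le> C" using Cauchy_Schwarz_ineq2[of "M k" "q k"] q(1)[of k] MC[of k] by simp
    moreover have "(norm (p j))\<^sup>2 \<le> V\<^sup>2" for j using pV[of j] by (intro power_mono) auto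
    moreover have "\<bar>c - (a + b) / 2\<bar> \<le> C + v" if "\<bar>c\<bar> \<le> C" "a \<le> v" "b \<le> v" "0 \<le> a" "0 \<le> b" for a b c v :: real
      using that by argo
    ultimately have "\<bar>M k \<bullet> q k - ((norm (p (k + 1)))\<^sup>2 + (norm (p k))\<^sup>2) / 2\<bar> \<le> C + V\<^sup>2"
      by simp
    then have "norm ((M k \<bullet> q k - ((norm (p (k + 1)))\<^sup>2 + (norm (p k))\<^sup>2) / 2) *\<^sub>R q k) \<le> C + V\<^sup>2"
      using q(1) by simp
    then have "norm ((M k \<bullet> q k - ((norm (p (k + 1)))\<^sup>2 + (norm (p k))\<^sup>2) / 2) *\<^sub>R q k - M k) \<le> (C + V\<^sup>2) + C"
      using MC[of k] norm_triangle_ineq4 order_trans add_mono by metis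
    then show ?thesis unfolding dp using h by simp
  qed
  define z where "z k = (q k, p k)" for k
  have "z k \<in> hemisphere_phase e V" for k
    using q pV by (simp add: z_def hemisphere_phase_def)
  moreover have "z (k + int n) = z k" for k
    using qper[of k] qper[of "k - 1"] by (simp add: z_def p_def D_def algebra_simps)
  moreover have "norm (z (k + 1) - z k - h *\<^sub>R sphere_field N (of_int k * h) (z k)) \<le> h * (h * ((2 * C + V\<^sup>2) * (1 + V)))" for k
  proof -
    define a where "a = norm (p (k + 1))"
    define b where "b = norm (p k)"
    \<comment> \<open>The position really advances with the velocity at \<open>k + 1\<close>, and
      the chain equation averages the squared speeds at \<open>k\<close> and \<open>k + 1\<close>;
      these are the two components of the defect.\<close>
    have "z (k + 1) - z k - h *\<^sub>R sphere_field N (of_int k * h) (z k) =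
      (h *\<^sub>R (p (k + 1) - p k), (p (k + 1) - p k) - h *\<^sub>R ((M k \<bullet> q k - b\<^sup>2) *\<^sub>R q k - M k))"
      using D[of "k + 1"] by (simp add: z_def sphere_field_def M_def D_def b_def algebra_simps)
    also have "(p (k + 1) - p k) - h *\<^sub>R ((M k \<bullet> q k - b\<^sup>2) *\<^sub>R q k - M k) = (h * ((b\<^sup>2 - a\<^sup>2) / 2)) *\<^sub>R q k"
      unfolding dp a_def b_def by (simp add: algebra_simps add_divide_distrib diff_divide_distrib flip: scaleR_add_left)
    finally have "norm (z (k + 1) - z k - h *\<^sub>R sphere_field N (of_int k * h) (z k))
      \<le> norm (h *\<^sub>R (p (k + 1) - p k)) + norm ((h * ((b\<^sup>2 - a\<^sup>2) / 2)) *\<^sub>R q k)"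
      by (simp only:) (rule norm_Pair_le)
    also have "\<dots> = h * (norm (p (k + 1) - p k) + \<bar>b\<^sup>2 - a\<^sup>2\<bar> / 2)"
      using h q(1) by (simp add: abs_mult distrib_left)
    also have "\<dots> \<le> h * (h * (2 * C + V\<^sup>2) + h * (2 * C + V\<^sup>2) * V)"
    proof -
      have "\<bar>b\<^sup>2 - a\<^sup>2\<bar> = \<bar>b - a\<bar> * \<bar>b + a\<bar>"
        by (simp add: power2_eq_square square_diff_square_factored abs_mult mult.commute)
      also have "\<dots> \<le> (h * (2 * C + V\<^sup>2)) * (2 * V)"
      proof (rule mult_mono)
        show "\<bar>b - a\<bar> \<le> h * (2 * C + V\<^sup>2)"
          using norm_triangle_ineq3[of "p (k + 1)" "p k"] dp_le[of k] by (simp add: a_def b_def)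
        show "\<bar>b + a\<bar> \<le> 2 * V" using pV[of k] pV[of "k + 1"] by (simp add: a_def b_def)
        show "0 \<le> h * (2 * C + V\<^sup>2)" using h C0 by simp
      qed simp
      finally show ?thesis using dp_le[of k] h by (intro mult_left_mono add_mono) auto
    qed
    finally show ?thesis by (simp add: algebra_simps)
  qed
  ultimately show ?thesis by blast
qed

section \<open>Existence of a periodic solution in the open hemisphere\<close>

theorem periodic_solution_in_hemisphere:
  fixes N :: "real \<Rightarrow> 'a::euclidean_space"
  assumes T: "T > 0" and cont: "continuous_on UNIV N" and per: "\<And>t. N (t + T) = N t"
    and e: "norm e = 1" and pos: "\<And>t. N t \<bullet> e > 0"
  obtains q p where "\<And>t. (q has_vector_derivative p t) (at t)"
    "\<And>t. (p has_vector_derivative (N t \<bullet> q t - (norm (p t))\<^sup>2) *\<^sub>R q t - N t) (at t)"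
    "\<And>t. norm (q t) = 1" "\<And>t. q t \<bullet> e > 0" "\<And>t. q (t + T) = q t"
proof -
  have "compact (N ` {0..T})"
    using cont by (intro compact_continuous_image) (auto intro: continuous_on_subset)
  then obtain C where C0T: "\<And>t. t \<in> {0..T} \<Longrightarrow> norm (N t) \<le> C"
    using compact_imp_bounded bounded_iff by (metis imageI)
  have C: "norm (N t) \<le> C" for t
  proof -
    have "N (t + T * of_int (k + 1)) = N (t + T * of_int k)" for k :: int
      using per[of "t + T * of_int k"] by (simp add: algebra_simps)
    \<comment> \<open>Sampling \<open>N\<close> at multiples of \<open>T\<close> gives an integer
      sequence of period 1.\<close>
    then have "N (t + T * of_int m) = N t" for m
      using periodic_int_mult[of "\<lambda>k. N (t + T * of_int k)" 1 0 m] by simp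
    from this[of "- \<lfloor>t / T\<rfloor>"] have "N (t - of_int \<lfloor>t / T\<rfloor> * T) = N t" by (simp add: mult.commute)
    moreover have "t - of_int \<lfloor>t / T\<rfloor> * T \<in> {0..T}"
      using floor_divide_lower[OF T, of t] floor_divide_upper[OF T, of t] by (simp add: algebra_simps)
    ultimately show ?thesis using C0T by metis
  qed
  have h0: "(\<lambda>n. T / of_nat n) \<longlonglongrightarrow> 0" by (rule lim_const_over_n)
  have "(\<lambda>n. 2 * T * C * (T / of_nat n) + (T / of_nat n)\<^sup>2 * C) \<longlonglongrightarrow> 2 * T * C * 0 + 0\<^sup>2 * C"
    by (intro tendsto_intros h0)
  then have "\<forall>\<^sub>F n in sequentially. 2 * T * C * (T / of_nat n) + (T / of_nat n)\<^sup>2 * C < 1"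
    by (rule order_tendstoD) simp
  then obtain n\<^sub>0 where n\<^sub>0: "\<And>n. n \<ge> n\<^sub>0 \<Longrightarrow> 2 * T * C * (T / of_nat n) + (T / of_nat n)\<^sup>2 * C < 1"
    unfolding eventually_sequentially by blast
  \<comment> \<open>The offset makes every member of the family, not only almost all, fine enough
    for the scheme and at least 2.\<close>
  define m where "m j = j + (n\<^sub>0 + 2)" for j
  define h where "h j = T / of_nat (m j)" for j
  define V where "V = sqrt (2 * C) + 2 * T * C"
  define A where "A = (2 * C + V\<^sup>2) * (1 + V)"
  have "\<exists>z :: int \<Rightarrow> 'a \<times> 'a. (\<forall>k. z k \<in> hemisphere_phase e V) \<and> (\<forall>k. z (k + int (m j)) = z k) \<and>
    (\<forall>k. norm (z (k + 1) - z k - h j *\<^sub>R sphere_field N (of_int k * h j) (z k)) \<le> h j * (h j * A))" for j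
    unfolding h_def V_def A_def using n\<^sub>0[of "m j"]
    by (intro hemisphere_difference_scheme T per e pos C) (auto simp: m_def)
  then obtain z :: "nat \<Rightarrow> int \<Rightarrow> 'a \<times> 'a" where z: "\<And>j k. z j k \<in> hemisphere_phase e V"
    "\<And>j k. z j (k + int (m j)) = z j k"
    "\<And>j k. norm (z j (k + 1) - z j k - h j *\<^sub>R sphere_field N (of_int k * h j) (z j k)) \<le> h j * (h j * A)"
    by metis
  have hl: "h \<longlonglongrightarrow> 0"
    unfolding h_def m_def using LIMSEQ_ignore_initial_segment[OF h0] .
  have hA: "(\<lambda>j. h j * A) \<longlonglongrightarrow> 0" using tendsto_mult_right[OF hl, of A] by simp
  have cf: "continuous_on UNIV (\<lambda>(t, y). sphere_field N t y)"
    unfolding sphere_field_def case_prod_beta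
    by (intro continuous_intros continuous_on_compose2[OF cont]) auto
  have "compact (hemisphere_phase e V)"
    unfolding hemisphere_phase_def by (intro compact_Times compact_hemisphere compact_cball)
  then obtain Z where Z: "\<And>t. (Z has_vector_derivative sphere_field N t (Z t)) (at t)"
    "\<And>t. Z t \<in> hemisphere_phase e V" "\<And>t. Z (t + T) = Z t"
    using difference_scheme_limit[OF cf _ z(1) _ hl hA z(3) _ z(2)] T by (auto simp: h_def m_def)
  define q where "q t = fst (Z t)" for t
  define p where "p t = snd (Z t)" for t
  have q': "(q has_vector_derivative p t) (at t)" for t
    using bounded_linear.has_vector_derivative[OF bounded_linear_fst Z(1)]
    by (simp add: q_def[abs_def] p_def sphere_field_def)
  have p': "(p has_vector_derivative (N t \<bullet> q t - (norm (p t))\<^sup>2) *\<^sub>R q t - N t) (at t)" for t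
    using bounded_linear.has_vector_derivative[OF bounded_linear_snd Z(1)]
    by (simp add: p_def[abs_def] q_def sphere_field_def)
  have q: "norm (q t) = 1" "q t \<bullet> e \<ge> 0" for t
    using Z(2)[of t] by (auto simp: q_def hemisphere_phase_def)
  have "q t \<bullet> e \<noteq> 0" for t
  \<comment> \<open>On the equator the height would have a minimum, with negative second derivative.\<close>
  proof
    assume 0: "q t \<bullet> e = 0"
    have w': "((\<lambda>t. q t \<bullet> e) has_real_derivative p t \<bullet> e) (at t)" for t
      using bounded_linear.has_vector_derivative[OF bounded_linear_inner_left q']
      by (simp add: has_real_derivative_iff_has_vector_derivative)
    have "((\<lambda>t. p t \<bullet> e) has_real_derivative ((N t \<bullet> q t - (norm (p t))\<^sup>2) *\<^sub>R q t - N t) \<bullet> e) (at t)"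
      using bounded_linear.has_vector_derivative[OF bounded_linear_inner_left p']
      by (simp add: has_real_derivative_iff_has_vector_derivative)
    then have w'': "((\<lambda>t. p t \<bullet> e) has_real_derivative - (N t \<bullet> e)) (at t)"
      using 0 by (simp add: inner_diff_left)
    have "p t \<bullet> e = 0" by (rule DERIV_local_min[OF w', of 1]) (use 0 q in auto)
    then obtain d where d: "d > 0" "\<And>s. 0 < s \<Longrightarrow> s < d \<Longrightarrow> p (t + s) \<bullet> e < 0"
      using DERIV_neg_dec_right[OF w''] pos[of t] by auto
    have "\<exists>s>t. s < t + d / 2 \<and> q (t + d / 2) \<bullet> e - q t \<bullet> e = (t + d / 2 - t) * (p s \<bullet> e)"
      using MVT2[of t "t + d / 2" "\<lambda>t. q t \<bullet> e" "\<lambda>t. p t \<bullet> e"] w' d by auto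
    then obtain s where s: "t < s" "s < t + d / 2" "q (t + d / 2) \<bullet> e = d / 2 * (p s \<bullet> e)"
      using 0 by auto
    have "p s \<bullet> e < 0" using d(2)[of "s - t"] s by simp
    then have "d / 2 * (p s \<bullet> e) < 0" using d(1) by (intro mult_pos_neg) auto
    then have "q (t + d / 2) \<bullet> e < 0" using s(3) by linarith
    then show False using q(2)[of "t + d / 2"] by simp
  qed
  then have "q t \<bullet> e > 0" for t using q(2)[of t] by (simp add: order_less_le)
  then show thesis
    using that[of q p] q' p' q(1) Z(3) by (auto simp: q_def)
qed

section \<open>Projection of the hemisphere solution to the unit disc\<close>

theorem theorem4p3:
  fixes G T :: real and F :: "real \<Rightarrow> real ^ 2"
  assumes "G > 0" and "T > 0"
    and "\<And>t. F (t + T) = F t"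
    and "\<exists>F'. (\<forall>t. (F has_vector_derivative F' t) (at t)) \<and> continuous_on UNIV F'"
  shows "\<exists>x x' x'' :: real \<Rightarrow> real ^ 2.
    (\<forall>t. (x has_vector_derivative x' t) (at t)) \<and>
    (\<forall>t. (x' has_vector_derivative x'' t) (at t)) \<and>
    (\<forall>t. norm (x t) < 1) \<and>
    (\<forall>t. x (t + T) = x t) \<and>
    (\<forall>t. x'' t =
        (G * sqrt (1 - (norm (x t))\<^sup>2) - (x t \<bullet> x' t)\<^sup>2 / (1 - (norm (x t))\<^sup>2)
           - (norm (x' t))\<^sup>2) *\<^sub>R x t
        + (x t \<bullet> F t) *\<^sub>R x t - F t)"
proof -
  have "continuous_on UNIV F"
    using assms(4) by (meson continuous_at_imp_continuous_on has_vector_derivative_continuous)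
  then have cont: "continuous_on UNIV (\<lambda>t. (F t, G))" by (intro continuous_intros)
  obtain q p :: "real \<Rightarrow> (real ^ 2) \<times> real" where q': "\<And>t. (q has_vector_derivative p t) (at t)"
    and p': "\<And>t. (p has_vector_derivative ((F t, G) \<bullet> q t - (norm (p t))\<^sup>2) *\<^sub>R q t - (F t, G)) (at t)"
    and q: "\<And>t. norm (q t) = 1" "\<And>t. q t \<bullet> (0, 1) > 0" "\<And>t. q (t + T) = q t"
    \<comment> \<open>With the pole \<open>(0, 1)\<close> the positivity of
      \<open>N t \<bullet> e\<close> is exactly \<open>G > 0\<close>.\<close>
    by (rule periodic_solution_in_hemisphere[OF \<open>T > 0\<close> cont, of "(0, 1)"]) (use assms(1,3) in auto)
  define x where "x t = fst (q t)" for t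
  define w where "w t = snd (q t)" for t
  define x' where "x' t = fst (p t)" for t
  define w' where "w' t = snd (p t)" for t
  define x'' where "x'' t = fst (((F t, G) \<bullet> q t - (norm (p t))\<^sup>2) *\<^sub>R q t - (F t, G))" for t
  have qq: "q t \<bullet> q t = 1" for t using q(1)[of t] by (simp add: dot_square_norm)
  then have xw: "(norm (x t))\<^sup>2 + (w t)\<^sup>2 = 1" for t
    using qq[of t] by (simp add: inner_prod_def x_def w_def dot_square_norm power2_eq_square)
  have w: "w t > 0" for t using q(2)[of t] by (simp add: w_def inner_prod_def)
  \<comment> \<open>Differentiate the constraint \<open>q t \<bullet> q t = 1\<close>.\<close>
  have "q t \<bullet> p t = 0" for t
  proof -
    have "((\<lambda>t. q t \<bullet> q t) has_derivative (\<lambda>s. q t \<bullet> (s *\<^sub>R p t) + (s *\<^sub>R p t) \<bullet> q t)) (at t)"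
      using q'[of t] unfolding has_vector_derivative_def by (intro derivative_intros)
    moreover have "((\<lambda>t. q t \<bullet> q t) has_derivative (\<lambda>s. 0)) (at t)" by (simp add: qq)
    ultimately have "(\<lambda>s. q t \<bullet> (s *\<^sub>R p t) + (s *\<^sub>R p t) \<bullet> q t) = (\<lambda>s. 0)" by (rule has_derivative_unique)
    from fun_cong[OF this, of 1] show ?thesis by (simp add: inner_commute)
  qed
  then have xx': "x t \<bullet> x' t = - (w t * w' t)" for t
    by (metis add_eq_0_iff2 inner_prod_def inner_real_def x_def w_def x'_def w'_def)
  have wsq: "1 - (norm (x t))\<^sup>2 = (w t)\<^sup>2" for t using xw[of t] by simp
  \<comment> \<open>Orthogonality turns the quotient in the equation into the squared vertical
    speed, so together with \<open>(norm (x' t))\<^sup>2\<close> it forms the full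
    \<open>(norm (p t))\<^sup>2\<close>; the square root is the height \<open>w t\<close>.\<close>
  have "norm (p t) ^ 2 = (norm (x' t))\<^sup>2 + (w' t)\<^sup>2" for t
    by (cases "p t") (simp add: norm_Pair x'_def w'_def)
  moreover have "(x t \<bullet> x' t)\<^sup>2 / (1 - (norm (x t))\<^sup>2) = (w' t)\<^sup>2" for t
    unfolding wsq xx' using w[of t] by (simp add: power_mult_distrib)
  moreover have "sqrt (1 - (norm (x t))\<^sup>2) = w t" for t
    unfolding wsq using w[of t] by simp
  ultimately have eq: "x'' t =
      (G * sqrt (1 - (norm (x t))\<^sup>2) - (x t \<bullet> x' t)\<^sup>2 / (1 - (norm (x t))\<^sup>2)
           - (norm (x' t))\<^sup>2) *\<^sub>R x t + (x t \<bullet> F t) *\<^sub>R x t - F t" for t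
    by (simp add: x''_def inner_prod_def x_def w_def inner_commute algebra_simps)
  have "(x has_vector_derivative x' t) (at t)" for t
    using bounded_linear.has_vector_derivative[OF bounded_linear_fst q'] by (simp add: x_def[abs_def] x'_def)
  moreover have "(x' has_vector_derivative x'' t) (at t)" for t
    using bounded_linear.has_vector_derivative[OF bounded_linear_fst p'] unfolding x'_def[abs_def] x''_def .
  moreover have "norm (x t) < 1" for t
  proof -
    have "0 < (w t)\<^sup>2" using w[of t] by simp
    then have "(norm (x t))\<^sup>2 < 1\<^sup>2" using xw[of t] unfolding one_power2 by linarith
    then show ?thesis by (rule power_less_imp_less_base) simp
  qed
  moreover have "x (t + T) = x t" for t by (simp add: x_def q(3))
  ultimately show ?thesis using eq by blast
qed

end
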